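(* If $n$ is a perfect number (i.e. $\sigma(n)=2n$), then $H_2(n)=\frac{n\,d^*(n)}{\sigma(n)}$ and $H_4(n)=\frac{n\,d^{**}(n)}{\sigma(n)}$ are integers. If $n>1$ and $H_2(n)$ is an integer, then $n$ is not a perfect square.
   Context: $\sigma(n)$ is the sum of the positive divisors of $n$. A divisor $d$ of $n$ is unitary if $\gcd(d,n/d)=1$; $d^*(n)$ is the number of unitary divisors of $n$. A divisor $d$ of $n$ is bi-unitary if the greatest common unitary divisor of $d$ and $n/d$ is $1$; $d^{**}(n)$ is the number of bi-unitary divisors of $n$. *)

theory Defs
  imports Complex_Main "HOL-Computational_Algebra.Nth_Powers"
begin

definition sigma :: "nat \<Rightarrow> nat" where
  "sigma n = (\<Sum>d | d dvd n. d)"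

(* Positivity is explicit: the divisor set of 0 is infinite, so sigma 0 = 0 = 2 * 0. *)
definition perfect :: "nat \<Rightarrow> bool" where
  "perfect n \<longleftrightarrow> n > 0 \<and> sigma n = 2 * n"

definition unitary_divisor :: "nat \<Rightarrow> nat \<Rightarrow> bool" where
  "unitary_divisor d n \<longleftrightarrow> d dvd n \<and> gcd d (n div d) = 1"

(* Meaningful for positive a and b: the set is then finite and contains 1. *)
definition gcud :: "nat \<Rightarrow> nat \<Rightarrow> nat" where
  "gcud a b = Max {d. unitary_divisor d a \<and> unitary_divisor d b}"

definition biunitary_divisor :: "nat \<Rightarrow> nat \<Rightarrow> bool" where
  "biunitary_divisor d n \<longleftrightarrow> d dvd n \<and> gcud d (n div d) = 1"

definition num_unitary_divisors :: "nat \<Rightarrow> nat" where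
  "num_unitary_divisors n = card {d. unitary_divisor d n}"

definition num_biunitary_divisors :: "nat \<Rightarrow> nat" where
  "num_biunitary_divisors n = card {d. biunitary_divisor d n}"

definition H2 :: "nat \<Rightarrow> real" where
  "H2 n = real n * real (num_unitary_divisors n) / real (sigma n)"

definition H4 :: "nat \<Rightarrow> real" where
  "H4 n = real n * real (num_biunitary_divisors n) / real (sigma n)"

end

theory Submission
  imports Defs
begin

text \<open>Both divisor families are closed under the complement map \<open>d \<mapsto> n div d\<close>, which has no fixed
  point on them when \<open>n > 1\<close>. Their cardinalities are therefore even, so for perfect \<open>n\<close> the
  quotients are halves of even numbers. For the last part, \<open>d\<^sup>*(n)\<close> is a power of two
  while \<open>\<sigma>(n)\<close> is odd for a square \<open>n\<close>; integrality would thus force \<open>\<sigma>(n)\<close> to divide \<open>n\<close>,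
  which contradicts \<open>\<sigma>(n) > n\<close>.\<close>

text \<open>The orbits of \<open>f\<close> on \<open>A\<close> are pairs \<open>{x, f x}\<close>.
  The linear order serves to single out one element of each pair: \<open>f\<close> exchanges the
  elements that it moves up with those that it moves down.\<close>

lemma even_card_involution:
  fixes A :: "'a :: linorder set"
  assumes "finite A" "\<And>x. x \<in> A \<Longrightarrow> f x \<in> A" "\<And>x. x \<in> A \<Longrightarrow> f (f x) = x" "\<And>x. x \<in> A \<Longrightarrow> f x \<noteq> x"
  shows "even (card A)"
proof -
  let ?L = "{x \<in> A. x < f x}" and ?G = "{x \<in> A. f x < x}"
  have "bij_betw f ?L ?G"
    by (rule bij_betw_byWitness[where f' = f]) (use assms in auto)
  then have "card ?L = card ?G"
    by (rule bij_betw_same_card)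
  moreover have "card A = card ?L + card ?G"
  proof -
    have "A = ?L \<union> ?G"
      using assms(4) by (auto simp: neq_iff)
    moreover have "card (?L \<union> ?G) = card ?L + card ?G"
      using assms(1) by (intro card_Un_disjoint) auto
    ultimately show ?thesis by simp
  qed
  ultimately show ?thesis by simp
qed

lemma div_div_self_nat:
  fixes d n :: nat
  assumes "d dvd n" "n > 0"
  shows "n div (n div d) = d"
  using assms by (auto elim!: dvdE)

lemma dvd_div_self_nat:
  fixes d n :: nat
  assumes "d dvd n"
  shows "n div d dvd n"
  using assms by (metis dvd_div_mult_self dvd_triv_left)

lemma even_num_unitary_divisors:
  assumes "n > 1"
  shows "even (num_unitary_divisors n)"
  unfolding num_unitary_divisors_def
proof (rule even_card_involution[where f = "\<lambda>d. n div d"])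
  show "finite {d. unitary_divisor d n}"
    by (rule finite_subset[of _ "{d. d dvd n}"]) (use assms in \<open>auto simp: unitary_divisor_def\<close>)
next
  fix d assume "d \<in> {d. unitary_divisor d n}"
  then have d: "d dvd n" "gcd d (n div d) = 1"
    by (auto simp: unitary_divisor_def)
  have inv: "n div (n div d) = d"
    using d assms by (intro div_div_self_nat) auto
  show "n div (n div d) = d" by fact
  show "n div d \<in> {d. unitary_divisor d n}"
    using d inv by (simp add: unitary_divisor_def gcd.commute dvd_div_self_nat)
  show "n div d \<noteq> d"
  proof
    assume "n div d = d"
    \<comment> \<open>At a fixed point the coprimality condition reads \<open>gcd d d = 1\<close>;
      the cofactor is then 1 as well, which would make \<open>n\<close> equal to 1.\<close>
    with d have "d = 1" by simp
    with \<open>n div d = d\<close> assms show False by simp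
  qed
qed

text \<open>A positive \<open>d\<close> is a unitary divisor of itself, its cofactor being 1. This
  rules out fixed points of the complement map among bi-unitary divisors, just as
  \<open>gcd d d = d\<close> does in the unitary case.\<close>

lemma gcud_self:
  assumes "d > 0"
  shows "gcud d d = d"
  unfolding gcud_def
proof (rule Max_eqI)
  show "finite {x. unitary_divisor x d \<and> unitary_divisor x d}"
    by (rule finite_subset[of _ "{x. x dvd d}"]) (use assms in \<open>auto simp: unitary_divisor_def\<close>)
qed (use assms in \<open>auto simp: unitary_divisor_def dvd_imp_le\<close>)

lemma gcud_commute: "gcud a b = gcud b a"
  by (simp add: gcud_def conj_commute)

lemma even_num_biunitary_divisors:
  assumes "n > 1"
  shows "even (num_biunitary_divisors n)"
  unfolding num_biunitary_divisors_def
proof (rule even_card_involution[where f = "\<lambda>d. n div d"])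
  show "finite {d. biunitary_divisor d n}"
    by (rule finite_subset[of _ "{d. d dvd n}"]) (use assms in \<open>auto simp: biunitary_divisor_def\<close>)
next
  fix d assume "d \<in> {d. biunitary_divisor d n}"
  then have d: "d dvd n" "gcud d (n div d) = 1"
    by (auto simp: biunitary_divisor_def)
  have "d > 0"
    using d(1) assms by (auto intro!: gr0I)
  have inv: "n div (n div d) = d"
    using d assms by (intro div_div_self_nat) auto
  show "n div (n div d) = d" by fact
  show "n div d \<in> {d. biunitary_divisor d n}"
    using d inv by (simp add: biunitary_divisor_def gcud_commute dvd_div_self_nat)
  show "n div d \<noteq> d"
  proof
    assume "n div d = d"
    with d \<open>d > 0\<close> have "d = 1" by (simp add: gcud_self)
    with \<open>n div d = d\<close> assms show False by simp
  qed
qed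

text \<open>A prime dividing \<open>d\<close> cannot divide the coprime cofactor, so its whole power
  in \<open>n\<close> lies in \<open>d\<close>. Hence a unitary divisor is determined by its set of
  primes.\<close>

lemma multiplicity_unitary_divisor:
  fixes n :: nat
  assumes "unitary_divisor d n" "n > 0" "p \<in> prime_factors d"
  shows "multiplicity p d = multiplicity p n"
proof -
  from assms(1) have d: "d dvd n" "coprime d (n div d)"
    by (auto simp: unitary_divisor_def coprime_iff_gcd_eq_1)
  from assms(3) have p: "prime p" "p dvd d"
    by (auto simp: in_prime_factors_iff)
  have n: "n = d * (n div d)"
    using d by simp
  have nz: "d \<noteq> 0" "n div d \<noteq> 0"
    using assms(2) d(1) by (auto simp: dvd_div_eq_0_iff)
  have "\<not> p dvd n div d"
    using d(2) p by (meson coprime_common_divisor not_prime_unit)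
  then have "multiplicity p (n div d) = 0"
    by (rule not_dvd_imp_multiplicity_0)
  moreover have "multiplicity p (d * (n div d)) = multiplicity p d + multiplicity p (n div d)"
    using p nz by (intro prime_elem_multiplicity_mult_distrib) auto
  ultimately show ?thesis
    by (simp flip: n)
qed

text \<open>Choosing a unitary divisor amounts to choosing which primes of \<open>n\<close> go into
  it: \<open>prime_factors\<close> is a bijection from the unitary divisors onto the subsets of the
  primes of \<open>n\<close>.\<close>

lemma num_unitary_divisors_eq:
  assumes "n > 0"
  shows "num_unitary_divisors n = 2 ^ card (prime_factors n)"
proof -
  \<comment> \<open>\<open>f S\<close> is the part of \<open>n\<close> supported on the primes in
    \<open>S\<close>; it will be the inverse of \<open>prime_factors\<close>.\<close>
  define f where "f = (\<lambda>S. \<Prod>p\<in>S. p ^ multiplicity p n)"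
  let ?P = "prime_factors n"
  have pf: "prime_factors (f S) = S" if S: "S \<subseteq> ?P" for S
  proof -
    have fin: "finite S"
      using S finite_subset by blast
    have "f S \<noteq> 0"
      using S fin unfolding f_def by auto
    have "p \<in> S" if p: "prime p" "p dvd f S" for p
    proof -
      obtain q where q: "q \<in> S" "p dvd q ^ multiplicity q n"
        using p fin unfolding f_def by (auto simp: prime_dvd_prod_iff)
      then have "p dvd q" using p(1) prime_dvd_power by blast
      moreover have "prime q" using q S by auto
      ultimately have "p = q" using p(1) primes_dvd_imp_eq by blast
      with q show ?thesis by simp
    qed
    moreover have "p dvd f S" if p: "p \<in> S" for p
    proof -
      have "multiplicity p n > 0"
        using p S by (auto simp: prime_factors_multiplicity)
      then have "p dvd p ^ multiplicity p n"
        by (intro dvd_power) auto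
      also have "\<dots> dvd f S"
        unfolding f_def using p fin by (intro dvd_prodI)
      finally show ?thesis .
    qed
    ultimately show ?thesis
      using S \<open>f S \<noteq> 0\<close> by (auto simp: in_prime_factors_iff)
  qed
  have unitary: "unitary_divisor (f S) n" if S: "S \<subseteq> ?P" for S
  proof -
    \<comment> \<open>The cofactor of \<open>f S\<close> is built from the complementary primes, so
      the two factors share no prime.\<close>
    have n: "n = f S * f (?P - S)"
    proof -
      have "n = f ?P"
        unfolding f_def using assms by (simp add: prod_prime_factors)
      also have "\<dots> = f (?P - S) * f S"
        unfolding f_def using S by (intro prod.subset_diff) auto
      also have "\<dots> = f S * f (?P - S)"
        by (rule mult.commute)
      finally show ?thesis .
    qed
    have "f S * f (?P - S) > 0"
      using assms by (simp flip: n)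
    then have nz: "f S > 0" "f (?P - S) > 0"
      by simp_all
    have "coprime (f S) (f (?P - S))"
    proof (rule ccontr)
      assume "\<not> coprime (f S) (f (?P - S))"
      then obtain p where "prime p" "p dvd gcd (f S) (f (?P - S))"
        using prime_factor_nat[of "gcd (f S) (f (?P - S))"] by (auto simp: coprime_iff_gcd_eq_1)
      then have "p \<in> prime_factors (f S)" "p \<in> prime_factors (f (?P - S))"
        using nz by (auto simp: in_prime_factors_iff)
      then show False using pf[of S] pf[of "?P - S"] S by auto
    qed
    moreover have "n div f S = f (?P - S)"
      using n nz(1) by (metis nonzero_mult_div_cancel_left less_irrefl)
    moreover have "f S dvd n"
      using n by (rule dvdI)
    ultimately show ?thesis
      by (simp add: unitary_divisor_def)
  qed
  have "bij_betw prime_factors {d. unitary_divisor d n} (Pow ?P)"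
  proof (rule bij_betw_byWitness[where f' = f])
    show "\<forall>d\<in>{d. unitary_divisor d n}. f (prime_factors d) = d"
    proof safe
      fix d assume d: "unitary_divisor d n"
      then have "d > 0"
        using assms by (auto simp: unitary_divisor_def intro: dvd_pos_nat)
      have "f (prime_factors d) = (\<Prod>p\<in>prime_factors d. p ^ multiplicity p d)"
        unfolding f_def using d assms by (intro prod.cong) (auto simp: multiplicity_unitary_divisor)
      also have "\<dots> = d"
        using \<open>d > 0\<close> by (simp add: prod_prime_factors)
      finally show "f (prime_factors d) = d" .
    qed
    show "prime_factors ` {d. unitary_divisor d n} \<subseteq> Pow ?P"
      using assms by (auto simp: unitary_divisor_def in_prime_factors_iff)
  qed (use pf unitary in auto)
  then have "card {d. unitary_divisor d n} = card (Pow ?P)"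
    by (rule bij_betw_same_card)
  then show ?thesis
    by (simp add: num_unitary_divisors_def card_Pow)
qed

text \<open>The complement map on the divisors of a square has exactly one fixed point, the root
  \<open>k\<close>; the remaining divisors fall into pairs.\<close>

lemma odd_card_divisors_square:
  fixes k :: nat
  assumes "k > 0"
  shows "odd (card {d. d dvd k\<^sup>2})"
proof -
  have fin: "finite {d. d dvd k\<^sup>2}"
    using assms by simp
  have "even (card ({d. d dvd k\<^sup>2} - {k}))"
  proof (rule even_card_involution[where f = "\<lambda>d. k\<^sup>2 div d"])
    fix d assume "d \<in> {d. d dvd k\<^sup>2} - {k}"
    then have d: "d dvd k\<^sup>2" "d \<noteq> k" by auto
    have inv: "k\<^sup>2 div (k\<^sup>2 div d) = d"
      using d assms by (intro div_div_self_nat) auto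
    show "k\<^sup>2 div (k\<^sup>2 div d) = d" by fact
    have "k\<^sup>2 div d \<noteq> k"
    proof
      assume "k\<^sup>2 div d = k"
      then have "d = k" using inv assms by (simp add: power2_eq_square)
      with d show False by simp
    qed
    with d(1) show "k\<^sup>2 div d \<in> {d. d dvd k\<^sup>2} - {k}"
      by (auto simp: dvd_div_self_nat)
    show "k\<^sup>2 div d \<noteq> d"
    proof
      assume "k\<^sup>2 div d = d"
      then have "d\<^sup>2 = k\<^sup>2" using d(1) by (metis dvd_div_mult_self power2_eq_square)
      with d show False by simp
    qed
  qed (use fin in auto)
  moreover have "card {d. d dvd k\<^sup>2} = Suc (card ({d. d dvd k\<^sup>2} - {k}))"
    using fin by (intro card.remove) (auto simp: power2_eq_square)
  ultimately show ?thesis by (simp only: even_Suc not_not)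
qed

text \<open>Modulo 2, \<open>sigma\<close> counts the odd divisors. Those of a square are all the
  divisors of the square of the odd part of the root, and their number is odd.\<close>

lemma odd_sigma_square:
  assumes "m > 0"
  shows "odd (sigma (m\<^sup>2))"
proof -
  obtain b k where k: "m = 2 ^ b * k" "odd k"
  proof (rule multiplicity_decompose'[of m 2])
    show "m \<noteq> 0" "\<not> is_unit (2 :: nat)"
      using assms by auto
  qed
  have "{d. d dvd m\<^sup>2 \<and> odd d} = {d. d dvd k\<^sup>2}"
  proof safe
    fix d assume d: "d dvd m\<^sup>2" "odd d"
    \<comment> \<open>An odd \<open>d\<close> is coprime to the power of two in
      \<open>m\<^sup>2\<close>, so it divides the remaining factor.\<close>
    then have "coprime d ((2 ^ b)\<^sup>2)" by simp
    then show "d dvd k\<^sup>2"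
      using d k by (simp add: power_mult_distrib coprime_dvd_mult_right_iff)
  next
    fix d assume d: "d dvd k\<^sup>2"
    then show "d dvd m\<^sup>2"
      using k by (simp add: power_mult_distrib)
    have "odd (k\<^sup>2)"
      using k by simp
    then show False if "even d"
      using d that dvd_trans by blast
  qed
  moreover have "odd (card {d. d dvd k\<^sup>2})"
    using k by (intro odd_card_divisors_square) (auto intro: odd_pos)
  ultimately show ?thesis
    unfolding sigma_def using assms by (simp add: even_sum_iff)
qed

lemma sigma_gt:
  assumes "n > 1"
  shows "sigma n > n"
proof -
  \<comment> \<open>As \<open>n > 1\<close>, the divisors 1 and \<open>n\<close> are distinct and
    already contribute \<open>n + 1\<close>.\<close>
  have "(\<Sum>d\<in>{1, n}. d) \<le> sigma n"
    unfolding sigma_def using assms by (intro sum_mono2) auto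
  then show ?thesis using assms by simp
qed

lemma divide_two_in_Ints:
  assumes "even m"
  shows "real m / 2 \<in> \<int>"
  using assms by auto

theorem theorem7:
  fixes n :: nat
  shows "(perfect n \<longrightarrow> H2 n \<in> \<int> \<and> H4 n \<in> \<int>) \<and>
         (n > 1 \<and> H2 n \<in> \<int> \<longrightarrow> \<not> is_nth_power 2 n)"
proof (intro conjI impI)
  assume p: "perfect n"
  then have n: "n > 0" "sigma n = 2 * n"
    by (auto simp: perfect_def)
  \<comment> \<open>\<open>sigma 1 = 1\<close> is not 2. The case 1 must be excluded because there
    the complement map fixes the only divisor, and both counts are odd.\<close>
  have "n \<noteq> 1"
    using n by (auto simp: sigma_def)
  with n have n1: "n > 1" by simp
  show "H2 n \<in> \<int>"
    using divide_two_in_Ints[OF even_num_unitary_divisors[OF n1]] n by (simp add: H2_def)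
  show "H4 n \<in> \<int>"
    using divide_two_in_Ints[OF even_num_biunitary_divisors[OF n1]] n by (simp add: H4_def)
next
  assume "n > 1 \<and> H2 n \<in> \<int>"
  then have n: "n > 1" and H: "H2 n \<in> \<int>" by auto
  let ?w = "card (prime_factors n)"
  show "\<not> is_nth_power 2 n"
  proof
    assume "is_nth_power 2 n"
    then obtain m where m: "n = m\<^sup>2" by (auto simp: is_nth_power_def)
    with n have "m > 0" by (auto intro: gr0I)
    have s: "sigma n > n" using n by (rule sigma_gt)
    from H obtain z where "H2 n = of_int z" by (auto elim: Ints_cases)
    then have "real n * 2 ^ ?w = of_int z * real (sigma n)"
      using s n by (simp add: H2_def num_unitary_divisors_eq field_simps)
    \<comment> \<open>Both sides are written as images of integers, so that the real equation can be
      pulled back to a divisibility, first over \<open>int\<close> and then over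
      \<open>nat\<close>.\<close>
    then have "real_of_int (int (n * 2 ^ ?w)) = real_of_int (z * int (sigma n))"
      by simp
    then have "int (n * 2 ^ ?w) = z * int (sigma n)"
      by (simp only: of_int_eq_iff)
    then have "int (sigma n) dvd int (n * 2 ^ ?w)"
      by simp
    then have "sigma n dvd n * 2 ^ ?w"
      by (simp only: int_dvd_int_iff)
    moreover have "coprime (sigma n) (2 ^ ?w)"
      using odd_sigma_square[OF \<open>m > 0\<close>] m by simp
    ultimately have "sigma n dvd n"
      by (simp add: coprime_dvd_mult_left_iff)
    then show False using s n by (auto dest: dvd_imp_le)
  qed
qed

end
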